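(* Consider the semi-discrete finite volume scheme on a curvilinear grid $$\Omega_{i,j}\frac{d}{dt}\mathbf q_{i,j}+\hat{\mathbf F}_{i+\frac12,j}A_{i+\frac12,j}-\hat{\mathbf F}_{i-\frac12,j}A_{i-\frac12,j}+\hat{\mathbf G}_{i,j+\frac12}A_{i,j+\frac12}-\hat{\mathbf G}_{i,j-\frac12}A_{i,j-\frac12}=\mathbf S_{i,j}$$ for the 2D Euler equations with gravity, with geometric quantities $\Omega_{i,j}$, $A_{i\pm\frac12,j}$, $A_{i,j\pm\frac12}$, source discretization $\mathbf S_{i,j}$, and numerical fluxes $\hat{\mathbf F},\hat{\mathbf G}$ evaluated at reconstructed face states, all as defined in the context. Let the numerical flux be any consistent numerical flux, and let the face states be obtained by any reconstruction applied to the variables $\mathbf w=(\rho/\alpha,\,u,\,v,\,p/\beta)^\top$. Then the scheme is well-balanced in the following sense: the initial condition given by $$u_{i,j}=v_{i,j}=0,\qquad \frac{\rho_{i,j}}{\alpha_{i,j}}=\rho_0=\text{const},\qquad \frac{p_{i,j}}{\beta_{i,j}}=p_0=\text{const},\qquad\text{for all }(i,j),$$ is preserved by the numerical scheme; that is, for this state the scheme gives $\frac{d}{dt}\mathbf q_{i,j}=0$ for all $(i,j)$.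
   Context: **Equations.** The 2D Euler equations with gravity are $\partial_t\mathbf q+\partial_x\mathbf f+\partial_y\mathbf g=\mathbf s$ with $$\mathbf q=\begin{bmatrix}\rho\\ \rho u\\ \rho v\\ E\end{bmatrix},\quad \mathbf f=\begin{bmatrix}\rho u\\ p+\rho u^2\\ \rho uv\\ (E+p)u\end{bmatrix},\quad \mathbf g=\begin{bmatrix}\rho v\\ \rho uv\\ p+\rho v^2\\ (E+p)v\end{bmatrix},\quad \mathbf s=\begin{bmatrix}0\\ -\rho\,\partial_x\phi\\ -\rho\,\partial_y\phi\\ 0\end{bmatrix},$$ where $\rho,p>0$, $\phi$ is a given gravitational potential, $E=\rho\varepsilon+\frac12\rho(u^2+v^2)+\rho\phi$, and the specific internal energy $\varepsilon$ is related to $\rho,p$ by an arbitrary given equation of state, so that at a given point the primitive variables $(\rho,u,v,p)$ determine $\mathbf q$. For a unit vector $n=(n_1,n_2)$ the flux in direction $n$ is $n_1\mathbf f+n_2\mathbf g$. **Hydrostatic solution.** A hydrostatic solution $(\bar\rho,\bar p)$ (i.e. $\nabla\bar p=-\bar\rho\nabla\phi$, zero velocity) is known a priori, and is written $\bar\rho(x,y)=\rho_0\,\alpha(x,y)$, $\bar p(x,y)=p_0\,\beta(x,y)$ with positive constants $\rho_0,p_0$ and positive functions $\alpha,\beta$. Subscripts on $\alpha,\beta$ denote values at grid locations: $\alpha_{i,j},\beta_{i,j}$ at the center $\mathbf x_{i,j}=(x_{i,j},y_{i,j})$ of cell $(i,j)$; $\alpha_{i+\frac12,j},\beta_{i+\frac12,j}$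 at the point $\mathbf x_{i+\frac12,j}$ of the face between cells $(i,j)$ and $(i+1,j)$; $\alpha_{i,j+\frac12},\beta_{i,j+\frac12}$ at the point $\mathbf x_{i,j+\frac12}$ of the face between cells $(i,j)$ and $(i,j+1)$. The same face points are used in the reconstruction and in the source term. **Grid.** The grid comes from a smooth bijective map from computational coordinates $(\xi,\eta)$ to physical coordinates $(x,y)$. Corner coordinates are $$y_{i+\frac12,j+\frac12}=\tfrac14(y_{i,j}+y_{i+1,j}+y_{i+1,j+1}+y_{i,j+1}),$$ and similarly for $x_{i+\frac12,j+\frac12}$. $\Omega_{i,j}>0$ is the physical area of cell $(i,j)$. The face lengths (positive) are $$A_{i+\frac12,j}=\sqrt{(x_{i+\frac12,j-\frac12}-x_{i+\frac12,j+\frac12})^2+(y_{i+\frac12,j-\frac12}-y_{i+\frac12,j+\frac12})^2},$$ $$A_{i,j+\frac12}=\sqrt{(x_{i+\frac12,j+\frac12}-x_{i-\frac12,j+\frac12})^2+(y_{i+\frac12,j+\frac12}-y_{i-\frac12,j+\frac12})^2},$$ and the unit normals are $$\ell_{i+\frac12,j}=\frac{1}{A_{i+\frac12,j}}\big[\,y_{i+\frac12,j+\frac12}-y_{i+\frac12,j-\frac12},\ -(x_{i+\frac12,j+\frac12}-x_{i+\frac12,j-\frac12})\,\big],$$ $$m_{i,j+\frac12}=\frac{1}{A_{i,j+\frac12}}\big[-(y_{i+\frac12,j+\frac12}-y_{i-\frac12,j+\frac12}),\ x_{i+\frac12,j+\frac12}-x_{i-\frac12,j+\frac12}\,\big].$$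 The discrete mesh derivatives are $$(y_\eta)_{i+\frac12,j}=y_{i+\frac12,j+\frac12}-y_{i+\frac12,j-\frac12},\qquad (y_\xi)_{i,j+\frac12}=y_{i+\frac12,j+\frac12}-y_{i-\frac12,j+\frac12},$$ and analogously $(x_\eta)_{i+\frac12,j}$, $(x_\xi)_{i,j+\frac12}$ with $x$ in place of $y$. **Numerical fluxes.** $\hat{\mathbf F}_{i+\frac12,j}=\hat{\mathbf F}(\mathbf q^L_{i+\frac12,j},\mathbf q^R_{i+\frac12,j},\ell_{i+\frac12,j})$ and $\hat{\mathbf G}_{i,j+\frac12}=\hat{\mathbf G}(\mathbf q^L_{i,j+\frac12},\mathbf q^R_{i,j+\frac12},m_{i,j+\frac12})$. Consistency means $\hat{\mathbf F}(\mathbf q,\mathbf q,\ell)=\ell_1\mathbf f(\mathbf q)+\ell_2\mathbf g(\mathbf q)$ and $\hat{\mathbf G}(\mathbf q,\mathbf q,m)=m_1\mathbf f(\mathbf q)+m_2\mathbf g(\mathbf q)$ for all states $\mathbf q$ and unit vectors $\ell=(\ell_1,\ell_2)$, $m=(m_1,m_2)$. **Reconstruction.** From the cell values $\mathbf w_{i,j}=(\rho_{i,j}/\alpha_{i,j},u_{i,j},v_{i,j},p_{i,j}/\beta_{i,j})^\top$ a reconstruction procedure produces left and right face values $\mathbf w^{L,R}_{i+\frac12,j}$, $\mathbf w^{L,R}_{i,j+\frac12}$. As usual, a reconstruction is understood to be exact on constant data: if $\mathbf w_{i,j}$ is the same vector for all $(i,j)$ (including any boundary/ghost cells), all face values equal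 that vector. The primitive face states are $$(\rho,u,v,p)^{\top,\,L/R}_{i+\frac12,j}=\mathrm{diag}\big(\alpha_{i+\frac12,j},1,1,\beta_{i+\frac12,j}\big)\,\mathbf w^{L/R}_{i+\frac12,j},$$ and similarly at faces $(i,j+\frac12)$. These are converted to conservative states $\mathbf q^{L/R}$ at the face by the same formula on the left and right (equation of state and $\phi$ at the face point). **Source term.** $\mathbf S_{i,j}=(S^{(1)}_{i,j},S^{(2)}_{i,j},S^{(3)}_{i,j},S^{(4)}_{i,j})^\top$ with $S^{(1)}_{i,j}=S^{(4)}_{i,j}=0$ and $$S^{(2)}_{i,j}=\frac{p_0\rho_{i,j}}{\rho_0\alpha_{i,j}}\Big\{\big[(y_\eta)_{i+\frac12,j}\beta_{i+\frac12,j}-(y_\eta)_{i-\frac12,j}\beta_{i-\frac12,j}\big]-\big[(y_\xi)_{i,j+\frac12}\beta_{i,j+\frac12}-(y_\xi)_{i,j-\frac12}\beta_{i,j-\frac12}\big]\Big\},$$ $$S^{(3)}_{i,j}=\frac{p_0\rho_{i,j}}{\rho_0\alpha_{i,j}}\Big\{-\big[(x_\eta)_{i+\frac12,j}\beta_{i+\frac12,j}-(x_\eta)_{i-\frac12,j}\beta_{i-\frac12,j}\big]+\big[(x_\xi)_{i,j+\frac12}\beta_{i,j+\frac12}-(x_\xi)_{i,j-\frac12}\beta_{i,j-\frac12}\big]\Big\}.$$ *)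

theory Defs
  imports "HOL-Analysis.Analysis"
begin

text \<open>
  Points of the plane and normals have type \<open>real^2\<close>.  States have type \<open>real^4\<close>: conservative
  states are \<open>(\<rho>, \<rho>u, \<rho>v, E)\<close>, primitive states are \<open>(\<rho>, u, v, p)\<close>, and the variables that are
  reconstructed are \<open>(\<rho>/\<alpha>, u, v, p/\<beta>)\<close>.

  Half-integer indices are encoded by rounding down: a face quantity \<open>a i j\<close> at an x-face is
  the one at \<open>(i+1/2, j)\<close>, at a y-face the one at \<open>(i, j+1/2)\<close>, and a corner quantity is the one
  at \<open>(i+1/2, j+1/2)\<close>.  Thus the index \<open>i - 1/2\<close> is written \<open>i - 1\<close>.
\<close>

type_synonym point = "real^2"
type_synonym state = "real^4"
type_synonym grid_data = "int \<Rightarrow> int \<Rightarrow> state"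

text \<open>
  The equation of state is the function \<open>eos\<close> giving the specific internal energy from \<open>(\<rho>, p)\<close>.
  The potential \<open>phi\<close> enters the total energy, so the conversion between primitive and
  conservative states depends on the point.
\<close>

record gravity_setting =
  eos :: "real \<Rightarrow> real \<Rightarrow> real"
  phi :: "point \<Rightarrow> real"
  rho0 :: real
  p0 :: real
  alpha :: "point \<Rightarrow> real"
  beta :: "point \<Rightarrow> real"

definition total_energy :: "gravity_setting \<Rightarrow> point \<Rightarrow> state \<Rightarrow> real" where
  "total_energy B x w = w$1 * eos B (w$1) (w$4) + 1/2 * w$1 * ((w$2)\<^sup>2 + (w$3)\<^sup>2) + w$1 * phi B x"

definition conservative :: "gravity_setting \<Rightarrow> point \<Rightarrow> state \<Rightarrow> state" where
  "conservative B x w = vector [w$1, w$1 * w$2, w$1 * w$3, total_energy B x w]"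

text \<open>The physical fluxes at the point \<open>x\<close>, in terms of the primitive state \<open>w\<close>.\<close>

definition flux_f :: "gravity_setting \<Rightarrow> point \<Rightarrow> state \<Rightarrow> state" where
  "flux_f B x w = vector [w$1 * w$2, w$4 + w$1 * (w$2)\<^sup>2, w$1 * w$2 * w$3,
     (total_energy B x w + w$4) * w$2]"

definition flux_g :: "gravity_setting \<Rightarrow> point \<Rightarrow> state \<Rightarrow> state" where
  "flux_g B x w = vector [w$1 * w$3, w$1 * w$2 * w$3, w$4 + w$1 * (w$3)\<^sup>2,
     (total_energy B x w + w$4) * w$3]"

definition hydrostatic_solution :: "point set \<Rightarrow> (point \<Rightarrow> real) \<Rightarrow> (point \<Rightarrow> real) \<Rightarrow> (point \<Rightarrow> real) \<Rightarrow> bool"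
  where
  "hydrostatic_solution P \<phi> rhobar pbar \<longleftrightarrow>
     (\<forall>x\<in>P. \<exists>D. GDERIV \<phi> x :> D \<and> GDERIV pbar x :> - (rhobar x *\<^sub>R D))"

definition hydrostatic_background :: "point set \<Rightarrow> gravity_setting \<Rightarrow> bool" where
  "hydrostatic_background P B \<longleftrightarrow>
     rho0 B > 0 \<and> p0 B > 0 \<and> (\<forall>x\<in>P. alpha B x > 0 \<and> beta B x > 0) \<and>
     hydrostatic_solution P (phi B) (\<lambda>x. rho0 B * alpha B x) (\<lambda>x. p0 B * beta B x)"

text \<open>
  \<open>updated_cells\<close> are the cells in which the scheme is applied; \<open>all_cells\<close> contains in addition
  the boundary (ghost) cells.  Both may be finite or infinite.  \<open>cell\<close> is the physical region
  occupied by a cell.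
\<close>

record grid =
  updated_cells :: "(int \<times> int) set"
  all_cells :: "(int \<times> int) set"
  center :: "int \<Rightarrow> int \<Rightarrow> point"
  xface_point :: "int \<Rightarrow> int \<Rightarrow> point"
  yface_point :: "int \<Rightarrow> int \<Rightarrow> point"
  cell :: "int \<Rightarrow> int \<Rightarrow> point set"

definition xfaces :: "grid \<Rightarrow> (int \<times> int) set" where
  "xfaces G = {(i, j). (i, j) \<in> updated_cells G \<or> (i + 1, j) \<in> updated_cells G}"

definition yfaces :: "grid \<Rightarrow> (int \<times> int) set" where
  "yfaces G = {(i, j). (i, j) \<in> updated_cells G \<or> (i, j + 1) \<in> updated_cells G}"

definition corner :: "grid \<Rightarrow> int \<Rightarrow> int \<Rightarrow> point" where
  "corner G i j =
     (1/4) *\<^sub>R (center G i j + center G (i + 1) j + center G (i + 1) (j + 1) + center G i (j + 1))"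

definition area :: "grid \<Rightarrow> int \<Rightarrow> int \<Rightarrow> real" where
  "area G i j = measure lebesgue (cell G i j)"

definition xface_length :: "grid \<Rightarrow> int \<Rightarrow> int \<Rightarrow> real" where
  "xface_length G i j =
     sqrt ((corner G i (j - 1) $ 1 - corner G i j $ 1)\<^sup>2 + (corner G i (j - 1) $ 2 - corner G i j $ 2)\<^sup>2)"

definition yface_length :: "grid \<Rightarrow> int \<Rightarrow> int \<Rightarrow> real" where
  "yface_length G i j =
     sqrt ((corner G i j $ 1 - corner G (i - 1) j $ 1)\<^sup>2 + (corner G i j $ 2 - corner G (i - 1) j $ 2)\<^sup>2)"

definition x_eta :: "grid \<Rightarrow> int \<Rightarrow> int \<Rightarrow> real" where
  "x_eta G i j = corner G i j $ 1 - corner G i (j - 1) $ 1"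

definition y_eta :: "grid \<Rightarrow> int \<Rightarrow> int \<Rightarrow> real" where
  "y_eta G i j = corner G i j $ 2 - corner G i (j - 1) $ 2"

definition x_xi :: "grid \<Rightarrow> int \<Rightarrow> int \<Rightarrow> real" where
  "x_xi G i j = corner G i j $ 1 - corner G (i - 1) j $ 1"

definition y_xi :: "grid \<Rightarrow> int \<Rightarrow> int \<Rightarrow> real" where
  "y_xi G i j = corner G i j $ 2 - corner G (i - 1) j $ 2"

definition xface_normal :: "grid \<Rightarrow> int \<Rightarrow> int \<Rightarrow> point" where
  "xface_normal G i j = (1 / xface_length G i j) *\<^sub>R
     vector [corner G i j $ 2 - corner G i (j - 1) $ 2, - (corner G i j $ 1 - corner G i (j - 1) $ 1)]"

definition yface_normal :: "grid \<Rightarrow> int \<Rightarrow> int \<Rightarrow> point" where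
  "yface_normal G i j = (1 / yface_length G i j) *\<^sub>R
     vector [- (corner G i j $ 2 - corner G (i - 1) j $ 2), corner G i j $ 1 - corner G (i - 1) j $ 1]"

text \<open>Continuous differentiability of order \<open>k\<close> on an open set, through directional derivatives.\<close>

primrec Ck_on :: "nat \<Rightarrow> (point \<Rightarrow> point) \<Rightarrow> point set \<Rightarrow> bool" where
  "Ck_on 0 f S \<longleftrightarrow> continuous_on S f"
| "Ck_on (Suc k) f S \<longleftrightarrow>
     f differentiable_on S \<and> (\<forall>v. Ck_on k (\<lambda>x. frechet_derivative f (at x) v) S)"

definition smooth_map :: "(point \<Rightarrow> point) \<Rightarrow> point set \<Rightarrow> bool" where
  "smooth_map f S \<longleftrightarrow> (\<forall>k. Ck_on k f S)"

text \<open>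
  \<open>X\<close> maps the computational coordinates \<open>(\<xi>, \<eta>)\<close> in \<open>C\<close> to the physical domain \<open>P\<close>.  The corners
  of an updated cell are averages over all its eight neighbours, which therefore have to be cells.
  No position is prescribed for the face points.
\<close>

definition curvilinear_grid :: "point set \<Rightarrow> grid \<Rightarrow> bool" where
  "curvilinear_grid P G \<longleftrightarrow>
     open P \<and>
     (\<exists>C X (\<xi> :: int \<Rightarrow> real) (\<eta> :: int \<Rightarrow> real).
        open C \<and> smooth_map X C \<and> bij_betw X C P \<and> strict_mono \<xi> \<and> strict_mono \<eta> \<and>
        (\<forall>(i, j) \<in> all_cells G. vector [\<xi> i, \<eta> j] \<in> C \<and> center G i j = X (vector [\<xi> i, \<eta> j]))) \<and>
     (\<forall>(i, j) \<in> updated_cells G. {i - 1..i + 1} \<times> {j - 1..j + 1} \<subseteq> all_cells G) \<and>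
     (\<forall>(i, j) \<in> updated_cells G. area G i j > 0) \<and>
     (\<forall>(i, j) \<in> xfaces G. xface_point G i j \<in> P \<and> xface_length G i j > 0) \<and>
     (\<forall>(i, j) \<in> yfaces G. yface_point G i j \<in> P \<and> yface_length G i j > 0)"

text \<open>
  Since \<open>E\<close> contains \<open>\<rho>\<phi>\<close>, the flux of a conservative state is determined only once the potential
  at the point is known; a numerical flux therefore takes the face point as first argument,
  followed by the left state, the right state and the unit normal.
\<close>

type_synonym num_flux = "point \<Rightarrow> state \<Rightarrow> state \<Rightarrow> point \<Rightarrow> state"

definition consistent_flux :: "point set \<Rightarrow> gravity_setting \<Rightarrow> num_flux \<Rightarrow> bool" where
  "consistent_flux P B H \<longleftrightarrow>
     (\<forall>x\<in>P. \<forall>w n. w$1 > 0 \<longrightarrow> w$4 > 0 \<longrightarrow> norm n = 1 \<longrightarrow>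
        H x (conservative B x w) (conservative B x w) n
          = n$1 *\<^sub>R flux_f B x w + n$2 *\<^sub>R flux_g B x w)"

text \<open>The reconstruction maps the array of cell values to the left and right values at all faces.\<close>

record reconstruction =
  xL :: "grid_data \<Rightarrow> grid_data"
  xR :: "grid_data \<Rightarrow> grid_data"
  yL :: "grid_data \<Rightarrow> grid_data"
  yR :: "grid_data \<Rightarrow> grid_data"

definition exact_on_constants :: "grid \<Rightarrow> reconstruction \<Rightarrow> bool" where
  "exact_on_constants G R \<longleftrightarrow>
     (\<forall>W c. (\<forall>(i, j) \<in> all_cells G. W i j = c) \<longrightarrow>
        (\<forall>(i, j) \<in> xfaces G. xL R W i j = c \<and> xR R W i j = c) \<and>
        (\<forall>(i, j) \<in> yfaces G. yL R W i j = c \<and> yR R W i j = c))"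

text \<open>The argument \<open>V\<close> is the array of primitive cell values.\<close>

definition scaled_variables :: "gravity_setting \<Rightarrow> grid \<Rightarrow> grid_data \<Rightarrow> grid_data" where
  "scaled_variables B G V i j =
     vector [V i j $ 1 / alpha B (center G i j), V i j $ 2, V i j $ 3, V i j $ 4 / beta B (center G i j)]"

text \<open>The product with \<open>diag(\<alpha>, 1, 1, \<beta>)\<close> at the point \<open>x\<close>.\<close>

definition unscale :: "gravity_setting \<Rightarrow> point \<Rightarrow> state \<Rightarrow> state" where
  "unscale B x w = vector [alpha B x * w$1, w$2, w$3, beta B x * w$4]"

definition face_state :: "gravity_setting \<Rightarrow> point \<Rightarrow> state \<Rightarrow> state" where
  "face_state B x w = conservative B x (unscale B x w)"

definition xface_flux ::
  "gravity_setting \<Rightarrow> grid \<Rightarrow> reconstruction \<Rightarrow> num_flux \<Rightarrow> grid_data \<Rightarrow> grid_data" where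
  "xface_flux B G R F V i j =
     (let x = xface_point G i j; W = scaled_variables B G V
      in F x (face_state B x (xL R W i j)) (face_state B x (xR R W i j)) (xface_normal G i j))"

definition yface_flux ::
  "gravity_setting \<Rightarrow> grid \<Rightarrow> reconstruction \<Rightarrow> num_flux \<Rightarrow> grid_data \<Rightarrow> grid_data" where
  "yface_flux B G R F V i j =
     (let x = yface_point G i j; W = scaled_variables B G V
      in F x (face_state B x (yL R W i j)) (face_state B x (yR R W i j)) (yface_normal G i j))"

definition source :: "gravity_setting \<Rightarrow> grid \<Rightarrow> grid_data \<Rightarrow> grid_data" where
  "source B G V i j =
     (let c = (p0 B * V i j $ 1) / (rho0 B * alpha B (center G i j));
          bx = (\<lambda>i j. beta B (xface_point G i j));
          by = (\<lambda>i j. beta B (yface_point G i j))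
      in vector [0,
           c * ((y_eta G i j * bx i j - y_eta G (i - 1) j * bx (i - 1) j)
              - (y_xi G i j * by i j - y_xi G i (j - 1) * by i (j - 1))),
           c * (- (x_eta G i j * bx i j - x_eta G (i - 1) j * bx (i - 1) j)
              + (x_xi G i j * by i j - x_xi G i (j - 1) * by i (j - 1))),
           0])"

text \<open>\<open>D\<close> takes the place of the time derivative of the conservative state of cell \<open>(i, j)\<close>.\<close>

definition scheme_equation ::
  "gravity_setting \<Rightarrow> grid \<Rightarrow> reconstruction \<Rightarrow> num_flux \<Rightarrow> num_flux \<Rightarrow> grid_data \<Rightarrow> state \<Rightarrow> int \<Rightarrow> int \<Rightarrow> bool"
  where
  "scheme_equation B G R Fhat Ghat V D i j \<longleftrightarrow>
     area G i j *\<^sub>R D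
       + xface_length G i j *\<^sub>R xface_flux B G R Fhat V i j
       - xface_length G (i - 1) j *\<^sub>R xface_flux B G R Fhat V (i - 1) j
       + yface_length G i j *\<^sub>R yface_flux B G R Ghat V i j
       - yface_length G i (j - 1) *\<^sub>R yface_flux B G R Ghat V i (j - 1)
     = source B G V i j"

text \<open>The conservative state of cell \<open>(i, j)\<close> along a time-dependent array of primitive cell values.\<close>

definition q_cell :: "gravity_setting \<Rightarrow> grid \<Rightarrow> (real \<Rightarrow> grid_data) \<Rightarrow> int \<Rightarrow> int \<Rightarrow> real \<Rightarrow> state" where
  "q_cell B G V i j t = conservative B (center G i j) (V t i j)"

definition satisfies_scheme_at ::
  "gravity_setting \<Rightarrow> grid \<Rightarrow> reconstruction \<Rightarrow> num_flux \<Rightarrow> num_flux \<Rightarrow> (real \<Rightarrow> grid_data) \<Rightarrow> real \<Rightarrow> bool"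
  where
  "satisfies_scheme_at B G R Fhat Ghat V t \<longleftrightarrow>
     (\<forall>(i, j) \<in> updated_cells G. \<exists>D.
        (q_cell B G V i j has_vector_derivative D) (at t within {0..}) \<and>
        scheme_equation B G R Fhat Ghat (V t) D i j)"

definition hydrostatic_state :: "gravity_setting \<Rightarrow> grid \<Rightarrow> grid_data \<Rightarrow> bool" where
  "hydrostatic_state B G V \<longleftrightarrow>
     (\<forall>(i, j) \<in> all_cells G.
        V i j $ 2 = 0 \<and> V i j $ 3 = 0 \<and>
        V i j $ 1 / alpha B (center G i j) = rho0 B \<and>
        V i j $ 4 / beta B (center G i j) = p0 B)"

text \<open>
  Whenever a solution of the scheme is in a hydrostatic state its time derivative vanishes, and
  the hydrostatic states, kept constant in time, are solutions of the scheme.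
\<close>

definition well_balanced ::
  "gravity_setting \<Rightarrow> grid \<Rightarrow> reconstruction \<Rightarrow> num_flux \<Rightarrow> num_flux \<Rightarrow> bool" where
  "well_balanced B G R Fhat Ghat \<longleftrightarrow>
     (\<forall>V t. t \<ge> 0 \<longrightarrow> hydrostatic_state B G (V t) \<longrightarrow> satisfies_scheme_at B G R Fhat Ghat V t \<longrightarrow>
        (\<forall>(i, j) \<in> updated_cells G. (q_cell B G V i j has_vector_derivative 0) (at t within {0..}))) \<and>
     (\<forall>V0. hydrostatic_state B G V0 \<longrightarrow> (\<forall>t\<ge>0. satisfies_scheme_at B G R Fhat Ghat (\<lambda>_. V0) t))"

end

theory Submission
  imports Defs
begin

text \<open>
  In a hydrostatic state the reconstructed variables are the constant vector \<open>(rho0, 0, 0, p0)\<close>,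
  so the left and right states agree at every face and have zero velocity.  By consistency each
  numerical flux is then the pressure \<open>p0 * beta\<close> times the normal, and multiplying it by the face
  length cancels the normalisation.  The flux differences thus become exactly the differences of
  mesh derivatives that make up the source term.
\<close>

definition hydrostatic_w :: "gravity_setting \<Rightarrow> state" where
  "hydrostatic_w B = vector [rho0 B, 0, 0, p0 B]"

lemma vector_4 [simp]:
  "(vector [a, b, c, d] :: 'a::zero ^ 4) $ 1 = a"
  "(vector [a, b, c, d] :: 'a ^ 4) $ 2 = b"
  "(vector [a, b, c, d] :: 'a ^ 4) $ 3 = c"
  "(vector [a, b, c, d] :: 'a ^ 4) $ 4 = d"
  unfolding vector_def by simp_all

lemma norm_vector_2: "norm (vector [a, b] :: real^2) = sqrt (a\<^sup>2 + b\<^sup>2)"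
  by (simp add: norm_vec_def L2_set_def sum_2)

text \<open>\<open>consistent_flux\<close> speaks only of unit normals. Before scaling, the normal
  is the edge between the two corners rotated by a quarter turn, so its norm is the face
  length.\<close>

lemma norm_xface_normal:
  assumes "xface_length G i j > 0"
  shows "norm (xface_normal G i j) = 1"
proof -
  have "norm (vector [corner G i j $ 2 - corner G i (j - 1) $ 2,
          - (corner G i j $ 1 - corner G i (j - 1) $ 1)] :: point) = xface_length G i j"
    unfolding norm_vector_2 xface_length_def by (simp add: power2_commute add.commute)
  then show ?thesis
    using assms by (simp add: xface_normal_def)
qed

lemma norm_yface_normal:
  assumes "yface_length G i j > 0"
  shows "norm (yface_normal G i j) = 1"
proof -
  have "norm (vector [- (corner G i j $ 2 - corner G (i - 1) j $ 2),
          corner G i j $ 1 - corner G (i - 1) j $ 1] :: point) = yface_length G i j"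
    unfolding norm_vector_2 yface_length_def by (simp add: power2_commute add.commute)
  then show ?thesis
    using assms by (simp add: yface_normal_def)
qed

text \<open>At zero velocity the mass, convective and energy fluxes vanish, and with them
  \<open>eos\<close> and \<open>phi\<close>; only the pressure survives. The background supplies the
  positivity that consistency asks for.\<close>

lemma consistent_flux_hydrostatic:
  assumes "consistent_flux P B H" "hydrostatic_background P B" "x \<in> P" "norm n = 1"
  shows "H x (face_state B x (hydrostatic_w B)) (face_state B x (hydrostatic_w B)) n
    = (p0 B * beta B x) *\<^sub>R vector [0, n$1, n$2, 0]"
proof -
  let ?w = "unscale B x (hydrostatic_w B)"
  have w: "?w$1 = alpha B x * rho0 B" "?w$2 = 0" "?w$3 = 0" "?w$4 = beta B x * p0 B"
    by (simp_all add: unscale_def hydrostatic_w_def)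
  have "?w$1 > 0" "?w$4 > 0"
    using assms(2,3) by (auto simp: w hydrostatic_background_def)
  then have "H x (conservative B x ?w) (conservative B x ?w) n
      = n$1 *\<^sub>R flux_f B x ?w + n$2 *\<^sub>R flux_g B x ?w"
    using assms(1,3,4) by (auto simp: consistent_flux_def)
  also have "\<dots> = (p0 B * beta B x) *\<^sub>R vector [0, n$1, n$2, 0]"
    by (simp add: vec_eq_iff forall_4 flux_f_def flux_g_def w)
  finally show ?thesis
    by (simp add: face_state_def)
qed

lemma scaled_variables_hydrostatic:
  assumes "hydrostatic_state B G V" "(i, j) \<in> all_cells G"
  shows "scaled_variables B G V i j = hydrostatic_w B"
  using assms by (auto simp: hydrostatic_state_def scaled_variables_def hydrostatic_w_def)

context
  fixes P G B R
  assumes grid: "curvilinear_grid P G"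
    and background: "hydrostatic_background P B"
    and exact: "exact_on_constants G R"
begin

text \<open>Stated for the product with the face length, where the normalisation cancels and the
  mesh derivatives of the source term appear.\<close>

lemma xface_flux_hydrostatic:
  assumes "consistent_flux P B F" "hydrostatic_state B G V" "(i, j) \<in> xfaces G"
  shows "xface_length G i j *\<^sub>R xface_flux B G R F V i j
    = (p0 B * beta B (xface_point G i j)) *\<^sub>R vector [0, y_eta G i j, - x_eta G i j, 0]"
proof -
  have face: "xface_point G i j \<in> P" "xface_length G i j > 0"
    using grid assms(3) by (auto simp: curvilinear_grid_def)
  have "\<forall>(i, j) \<in> all_cells G. scaled_variables B G V i j = hydrostatic_w B"
    using assms(2) scaled_variables_hydrostatic by blast
  with exact assms(3)
  have "xL R (scaled_variables B G V) i j = hydrostatic_w B"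
       "xR R (scaled_variables B G V) i j = hydrostatic_w B"
    unfolding exact_on_constants_def by blast+
  then have "xface_flux B G R F V i j = (p0 B * beta B (xface_point G i j)) *\<^sub>R
      vector [0, xface_normal G i j $ 1, xface_normal G i j $ 2, 0]"
    using consistent_flux_hydrostatic[OF assms(1) background face(1) norm_xface_normal[OF face(2)]]
    by (simp add: xface_flux_def)
  then show ?thesis
    using face(2) by (simp add: vec_eq_iff forall_4 xface_normal_def y_eta_def x_eta_def)
qed

text \<open>The signs are opposite to those at x-faces because this normal rotates the edge
  counterclockwise, the other one clockwise.\<close>

lemma yface_flux_hydrostatic:
  assumes "consistent_flux P B F" "hydrostatic_state B G V" "(i, j) \<in> yfaces G"
  shows "yface_length G i j *\<^sub>R yface_flux B G R F V i j
    = (p0 B * beta B (yface_point G i j)) *\<^sub>R vector [0, - y_xi G i j, x_xi G i j, 0]"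
proof -
  have face: "yface_point G i j \<in> P" "yface_length G i j > 0"
    using grid assms(3) by (auto simp: curvilinear_grid_def)
  have "\<forall>(i, j) \<in> all_cells G. scaled_variables B G V i j = hydrostatic_w B"
    using assms(2) scaled_variables_hydrostatic by blast
  with exact assms(3)
  have "yL R (scaled_variables B G V) i j = hydrostatic_w B"
       "yR R (scaled_variables B G V) i j = hydrostatic_w B"
    unfolding exact_on_constants_def by blast+
  then have "yface_flux B G R F V i j = (p0 B * beta B (yface_point G i j)) *\<^sub>R
      vector [0, yface_normal G i j $ 1, yface_normal G i j $ 2, 0]"
    using consistent_flux_hydrostatic[OF assms(1) background face(1) norm_yface_normal[OF face(2)]]
    by (simp add: yface_flux_def)
  then show ?thesis
    using face(2) by (simp add: vec_eq_iff forall_4 yface_normal_def y_xi_def x_xi_def)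
qed

text \<open>The equivalence serves both halves of \<open>well_balanced\<close>: left to right forces
  a derivative to vanish, right to left makes constant states solutions.\<close>

lemma scheme_equation_hydrostatic:
  assumes F: "consistent_flux P B Fhat" and G: "consistent_flux P B Ghat"
    and V: "hydrostatic_state B G V" and ij: "(i, j) \<in> updated_cells G"
  shows "scheme_equation B G R Fhat Ghat V D i j \<longleftrightarrow> D = 0"
proof -
  have "{i - 1..i + 1} \<times> {j - 1..j + 1} \<subseteq> all_cells G" and area: "area G i j > 0"
    using grid ij by (auto simp: curvilinear_grid_def)
  then have "(i, j) \<in> all_cells G"
    by auto
  then have "V i j $ 1 / alpha B (center G i j) = rho0 B"
    using V by (auto simp: hydrostatic_state_def)
  moreover have "rho0 B > 0"
    using background by (simp add: hydrostatic_background_def)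
  \<comment> \<open>Regrouping exposes the ratio equal to \<open>rho0 B\<close>, so the source
    prefactor reduces to \<open>p0 B\<close>, the factor in the face fluxes.\<close>
  moreover have "(p0 B * V i j $ 1) / (rho0 B * alpha B (center G i j))
      = p0 B / rho0 B * (V i j $ 1 / alpha B (center G i j))"
    by simp
  ultimately have coeff: "(p0 B * V i j $ 1) / (rho0 B * alpha B (center G i j)) = p0 B"
    by simp
  \<comment> \<open>The four faces of the cell; index \<open>i - 1\<close> stands for i -
    1/2.\<close>
  have faces: "(i, j) \<in> xfaces G" "(i - 1, j) \<in> xfaces G"
      "(i, j) \<in> yfaces G" "(i, j - 1) \<in> yfaces G"
    using ij by (auto simp: xfaces_def yfaces_def)
  have "xface_length G i j *\<^sub>R xface_flux B G R Fhat V i j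
      - xface_length G (i - 1) j *\<^sub>R xface_flux B G R Fhat V (i - 1) j
      + yface_length G i j *\<^sub>R yface_flux B G R Ghat V i j
      - yface_length G i (j - 1) *\<^sub>R yface_flux B G R Ghat V i (j - 1) = source B G V i j"
    unfolding source_def Let_def coeff
      xface_flux_hydrostatic[OF F V faces(1)] xface_flux_hydrostatic[OF F V faces(2)]
      yface_flux_hydrostatic[OF G V faces(3)] yface_flux_hydrostatic[OF G V faces(4)]
    by (simp add: vec_eq_iff forall_4 algebra_simps)
  \<comment> \<open>The fluxes balance the source, so only the term with \<open>D\<close>
    remains.\<close>
  then have "scheme_equation B G R Fhat Ghat V D i j \<longleftrightarrow> area G i j *\<^sub>R D = 0"
    unfolding scheme_equation_def by (auto simp: algebra_simps)
  then show ?thesis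
    using area by simp
qed

end

theorem theorem4p1:
  fixes P :: "(real^2) set"
    and G :: grid
    and B :: gravity_setting
    and R :: reconstruction
    and Fhat Ghat :: num_flux
  assumes "curvilinear_grid P G"
    and "hydrostatic_background P B"
    and "consistent_flux P B Fhat"
    and "consistent_flux P B Ghat"
    and "exact_on_constants G R"
  shows "well_balanced B G R Fhat Ghat"
proof -
  note scheme = scheme_equation_hydrostatic[OF assms(1,2,5,3,4)]
  have "(q_cell B G V i j has_vector_derivative 0) (at t within {0..})"
    if V: "hydrostatic_state B G (V t)" and eq: "satisfies_scheme_at B G R Fhat Ghat V t"
      and ij: "(i, j) \<in> updated_cells G" for V t i j
  proof -
    obtain D where "(q_cell B G V i j has_vector_derivative D) (at t within {0..})"
        "scheme_equation B G R Fhat Ghat (V t) D i j"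
      using eq ij by (auto simp: satisfies_scheme_at_def)
    then show ?thesis
      by (simp add: scheme[OF V ij])
  qed
  \<comment> \<open>The witness is \<open>D = 0\<close>, the derivative of a function constant in
    time.\<close>
  moreover have "satisfies_scheme_at B G R Fhat Ghat (\<lambda>_. V) t"
    if "hydrostatic_state B G V" for V t
    using scheme[OF that] by (auto simp: satisfies_scheme_at_def q_cell_def[abs_def])
  ultimately show ?thesis
    by (auto simp: well_balanced_def)
qed

end
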